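(* Let $s\in(0,\tfrac18)$, $a=1-\sqrt{2s}\in(\tfrac12,1)$, $r\ge 0$, and suppose both firms charge the same exogenously given price $p_1=p_2=p$ with $0\le p\le a$. If $r>\frac{1-a}{a}\,p$, then the profit of the prominent firm (Firm 1) is lower than that of the non-prominent firm (Firm 2): $\pi_1(p,p)<\pi_2(p,p)$.
   Context: Two firms sell one product each at zero marginal cost. Consumers (unit mass) have match values $u_1,u_2$ for the two products, i.i.d. uniform on $[0,1]$. Firm 1 is prominent: every consumer first searches and buys product 1 at no search cost, thereby learning $u_1$. Searching and buying product 2 costs $s\in(0,1/8)$; $u_2$ is learned only after buying it. Returns give consumers a full refund and cost the firm $r$ per returned unit. With $a=1-\sqrt{2s}$, a consumer with $u_1\ge a+p_1-p_2$ keeps product 1 and stops; a consumer with $u_1<a+p_1-p_2$ also buys product 2, returns both products if $u_i-p_i<0$ for $i=1,2$, and otherwise keeps the product with the larger $u_i-p_i$ and returns the other. Under the conditions $p_2\le a$ and $a-p_2+p_1\le 1$, put $$d_1^n=1-a+p_2-p_1,\quad k_1=\tfrac12(a^2-p_2^2),\quad d_2^r=(a-p_2+p_1)(1-a),\quad k_2=\tfrac{a^2-p_2^2}{2}+(p_1-p_2)(a-p_2).$$ The profits are $$\pi_1(p_1,p_2)=(p_1+r)(d_1^n+k_1)-r,\qquad \pi_2(p_1,p_2)=(p_2+r)(d_2^r+k_2)-r(1-d_1^n).$$ *)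

theory Defs imports Complex_Main begin

text \<open>
  Match values \<open>u1, u2\<close> are independent and uniform on \<open>[0,1]\<close>; search cost \<open>s\<close>, return
  cost \<open>r\<close>, prices \<open>p1, p2\<close>. A consumer stops at firm 1 iff \<open>u1 \<ge> a + p1 - p2\<close>, where
  \<open>a\<close> is the reservation value below. The demand formulas describe these consumers
  under the conditions \<open>p2 \<le> a\<close> and \<open>a - p2 + p1 \<le> 1\<close>.
\<close>

definition reservation_value :: "real \<Rightarrow> real"
  where "reservation_value s = 1 - sqrt (2 * s)"

text \<open>Mass of consumers who keep product 1 without searching product 2.\<close>

definition d1n :: "real \<Rightarrow> real \<Rightarrow> real \<Rightarrow> real"
  where "d1n a p1 p2 = 1 - a + p2 - p1"

text \<open>
  Mass of consumers who buy both products and keep product 1: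
  \<open>u1 < a + p1 - p2\<close>, \<open>u1 \<ge> p1\<close> and \<open>u1 - p1 > u2 - p2\<close>. It does not depend on \<open>p1\<close>.
\<close>

definition k1 :: "real \<Rightarrow> real \<Rightarrow> real"
  where "k1 a p2 = (1 / 2) * (a\<^sup>2 - p2\<^sup>2)"

text \<open>
  Consumers who buy both products and keep product 2 are split by \<open>u2\<close>:
  \<open>d2r\<close> is the mass of those with \<open>u2 \<ge> a\<close>, \<open>k2\<close> of those with \<open>p2 \<le> u2 < a\<close>.
\<close>

definition d2r :: "real \<Rightarrow> real \<Rightarrow> real \<Rightarrow> real"
  where "d2r a p1 p2 = (a - p2 + p1) * (1 - a)"

definition k2 :: "real \<Rightarrow> real \<Rightarrow> real \<Rightarrow> real"
  where "k2 a p1 p2 = (a\<^sup>2 - p2\<^sup>2) / 2 + (p1 - p2) * (a - p2)"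

text \<open>
  Price times units kept, minus \<open>r\<close> times units returned. Firm 1 sells to everyone, firm 2
  to the mass \<open>1 - d1n\<close> of consumers who search on.
\<close>

definition profit1 :: "real \<Rightarrow> real \<Rightarrow> real \<Rightarrow> real \<Rightarrow> real"
  where "profit1 s r p1 p2 =
    (let a = reservation_value s in (p1 + r) * (d1n a p1 p2 + k1 a p2) - r)"

definition profit2 :: "real \<Rightarrow> real \<Rightarrow> real \<Rightarrow> real \<Rightarrow> real"
  where "profit2 s r p1 p2 =
    (let a = reservation_value s in
      (p2 + r) * (d2r a p1 p2 + k2 a p1 p2) - r * (1 - d1n a p1 p2))"

end

theory Submission imports Defs begin

text \<open>At equal prices \<open>k1\<close> and \<open>k2\<close> cancel. Firm 1 keeps
  \<open>(1 - a)\<^sup>2\<close> more units, each worth \<open>p + r\<close>, but ships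
  \<open>1 - a\<close> more, each charged \<open>r\<close>. The net gap factors, and its second
  factor changes sign exactly at the threshold for \<open>r\<close>.\<close>

lemma profit_difference:
  assumes "a = reservation_value s"
  shows "profit2 s r p p - profit1 s r p p = (1 - a) * (a * r - (1 - a) * p)"
  unfolding profit1_def profit2_def d1n_def d2r_def k1_def k2_def Let_def assms[symmetric]
  by (simp add: field_simps power2_eq_square)

theorem proposition1:
  fixes s a r p :: real
  assumes "0 < s" and "s < 1 / 8"
    and "a = reservation_value s"
    and "0 \<le> r"
    and "0 \<le> p" and "p \<le> a"
    and "r > (1 - a) / a * p"
  shows "profit1 s r p p < profit2 s r p p"
proof -
  have "sqrt (2 * s) < 1"
    using assms(2) by simp
  with assms(1,3) have a: "0 < a" "a < 1"
    by (simp_all add: reservation_value_def)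
  \<comment> \<open>Multiplying the threshold by \<open>a > 0\<close> makes the second factor
    positive; \<open>a < 1\<close> does so for the first.\<close>
  with assms(7) have "(1 - a) * p < a * r"
    by (simp add: field_simps)
  with a have "0 < (1 - a) * (a * r - (1 - a) * p)"
    by simp
  with profit_difference[OF assms(3)] show ?thesis
    by (metis diff_gt_0_iff_gt)
qed

end
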